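(* Let $(a_i)$ be a computable increasing sequence of rational numbers converging to a real $\alpha$. The observer has a computable winning strategy in the prediction game for $(a_i)$ if and only if $\alpha$ is not Martin-Löf random.
   Context: Prediction game for a sequence $(a_i)$: the observer is given in advance a rational $\varepsilon>0$, then watches the terms $a_0,a_1,\dots$ one by one, and from time to time, after seeing the current term $a_i$, may make a prediction of the form "the sequence will never increase by more than $\delta$ compared to its current value", i.e. $a_j\le a_i+\delta$ for all $j\ge i$, where $\delta\ge 0$ is rational. The observer wins if (1) at least one of the predictions remains true forever and (2) the sum of all the numbers $\delta$ used in the predictions is less than $\varepsilon$. A computable winning strategy is an algorithm that, given $\varepsilon$ and the terms of the sequence as they appear, produces the predictions and wins for every rational $\varepsilon>0$. *)

theory Defs
  imports "HOL-Analysis.Analysis" "HOL-Library.Nat_Bijection"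
begin

subsection \<open>Partial recursive functions\<close>

text \<open>
  Kleene's partial recursive functions, given by programs and their big-step evaluation. The arity
  is not part of a program: it is the length of the argument list. In \<open>PrimRec\<close> and \<open>Minim\<close> the
  recursion variable and the search variable come first.
\<close>

datatype program =
    Zero
  | Succ
  | Proj nat
  | Comp program "program list"
  | PrimRec program program
  | Minim program

inductive evaluates :: "program \<Rightarrow> nat list \<Rightarrow> nat \<Rightarrow> bool" where
  zero: "evaluates Zero xs 0"
| succ: "evaluates Succ [x] (Suc x)"
| proj: "i < length xs \<Longrightarrow> evaluates (Proj i) xs (xs ! i)"
| comp: "list_all2 (\<lambda>g y. evaluates g xs y) gs ys \<Longrightarrow> evaluates f ys z
    \<Longrightarrow> evaluates (Comp f gs) xs z"
| rec_0: "evaluates f xs y \<Longrightarrow> evaluates (PrimRec f g) (0 # xs) y"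
| rec_Suc: "evaluates (PrimRec f g) (n # xs) y \<Longrightarrow> evaluates g (n # y # xs) z
    \<Longrightarrow> evaluates (PrimRec f g) (Suc n # xs) z"
| minim: "evaluates f (n # xs) 0 \<Longrightarrow> (\<forall>m<n. \<exists>k. evaluates f (m # xs) (Suc k))
    \<Longrightarrow> evaluates (Minim f) xs n"

inductive_cases evaluates_ZeroE: "evaluates Zero xs y"
inductive_cases evaluates_SuccE: "evaluates Succ xs y"
inductive_cases evaluates_ProjE: "evaluates (Proj i) xs y"
inductive_cases evaluates_CompE: "evaluates (Comp f gs) xs y"
inductive_cases evaluates_PrimRec_0E: "evaluates (PrimRec f g) (0 # xs) y"
inductive_cases evaluates_PrimRec_SucE: "evaluates (PrimRec f g) (Suc n # xs) y"
inductive_cases evaluates_MinimE: "evaluates (Minim f) xs y"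

lemma evaluates_deterministic:
  "evaluates p xs y \<Longrightarrow> evaluates p xs z \<Longrightarrow> y = z"
proof (induction arbitrary: z rule: evaluates.induct)
  case (zero xs)
  then show ?case by (rule evaluates_ZeroE) simp
next
  case (succ x)
  then show ?case by (rule evaluates_SuccE) simp
next
  case (proj i xs)
  from proj.prems show ?case by (rule evaluates_ProjE) simp
next
  case (comp xs gs ys f w)
  from comp.prems obtain ys' where ys': "list_all2 (\<lambda>g y. evaluates g xs y) gs ys'"
    and f: "evaluates f ys' z"
    by (rule evaluates_CompE)
  have "ys = ys'"
    using comp.IH(1) ys' by (simp add: list_all2_conv_all_nth list_eq_iff_nth_eq)
  with f comp.IH(2) show ?case by blast
next
  case (rec_0 f xs y g)
  from rec_0.prems rec_0.IH show ?case by (blast elim: evaluates_PrimRec_0E)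
next
  case (rec_Suc f g n xs y w)
  from rec_Suc.prems obtain y' where "evaluates (PrimRec f g) (n # xs) y'"
    and "evaluates g (n # y' # xs) z"
    by (rule evaluates_PrimRec_SucE)
  with rec_Suc.IH show ?case by metis
next
  case (minim f n xs)
  from minim.prems have z: "evaluates f (z # xs) 0"
    and less_z: "\<forall>m<z. \<exists>k. evaluates f (m # xs) (Suc k)"
    by (blast elim: evaluates_MinimE)+
  show ?case
  proof (cases n z rule: linorder_cases)
    case less
    with less_z minim.IH(1) show ?thesis by blast
  next
    case greater
    with minim.IH(2) z show ?thesis by blast
  qed
qed


subsection \<open>Computable functions on coded data\<close>

text \<open>
  The library's \<open>to_nat\<close> is an unspecified injection, hence useless for computability; the codings
  below are the explicit ones. Rationals are coded by numerator and denominator in lowest terms.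
\<close>

class encodable =
  fixes encode :: "'a \<Rightarrow> nat"
  assumes inj_encode: "inj encode"

instantiation nat :: encodable
begin
definition "encode (n :: nat) = n"
instance by standard (simp add: encode_nat_def inj_def)
end

instantiation rat :: encodable
begin
definition "encode (r :: rat) =
  prod_encode (int_encode (fst (quotient_of r)), int_encode (snd (quotient_of r)))"
instance
  by standard (simp add: encode_rat_def inj_def int_encode_eq quotient_of_inject_eq flip: prod_eq_iff)
end

instantiation prod :: (encodable, encodable) encodable
begin
definition "encode (x :: 'a \<times> 'b) = prod_encode (encode (fst x), encode (snd x))"
instance
  by standard (auto simp: encode_prod_def inj_def prod_eq_iff inj_eq[OF inj_encode])
end

instantiation option :: (encodable) encodable
begin
definition "encode (x :: 'a option) = (case x of None \<Rightarrow> 0 | Some y \<Rightarrow> Suc (encode y))"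
instance
  by standard (auto simp: encode_option_def inj_def inj_eq[OF inj_encode] split: option.splits)
end

instantiation list :: (encodable) encodable
begin
definition "encode (xs :: 'a list) = list_encode (map encode xs)"
instance
  by standard (simp add: encode_list_def inj_def list_encode_eq inj_map_eq_map[OF inj_encode])
end

text \<open>The algorithm may behave arbitrarily (in particular, diverge) on inputs outside \<open>D\<close>.\<close>

definition computable_on :: "'a::encodable set \<Rightarrow> ('a \<Rightarrow> 'b::encodable) \<Rightarrow> bool" where
  "computable_on D f \<longleftrightarrow> (\<exists>p. \<forall>x\<in>D. evaluates p [encode x] (encode (f x)))"

abbreviation computable :: "('a::encodable \<Rightarrow> 'b::encodable) \<Rightarrow> bool" where
  "computable \<equiv> computable_on UNIV"


subsection \<open>Martin-Loef randomness\<close>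

text \<open>
  \<open>V n\<close> enumerates rational open intervals whose union is the \<open>n\<close>th set of the test. An interval
  whose endpoints satisfy \<open>p \<ge> q\<close> is empty, so that finite enumerations are included.
\<close>

definition test_set :: "(nat \<Rightarrow> nat \<Rightarrow> rat \<times> rat) \<Rightarrow> nat \<Rightarrow> real set" where
  "test_set V n = (\<Union>k. {of_rat (fst (V n k)) <..< of_rat (snd (V n k))})"

definition martin_loef_test :: "(nat \<Rightarrow> nat \<Rightarrow> rat \<times> rat) \<Rightarrow> bool" where
  "martin_loef_test V \<longleftrightarrow>
     computable (\<lambda>(n, k). V n k) \<and>
     (\<forall>n. emeasure lborel (test_set V n) \<le> ennreal (1 / 2 ^ n))"

definition martin_loef_random :: "real \<Rightarrow> bool" where
  "martin_loef_random \<alpha> \<longleftrightarrow> \<not> (\<exists>V. martin_loef_test V \<and> (\<forall>n. \<alpha> \<in> test_set V n))"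


subsection \<open>The prediction game\<close>

definition prediction_cost :: "rat option \<Rightarrow> real" where
  "prediction_cost p = (case p of None \<Rightarrow> 0 | Some \<delta> \<Rightarrow> of_rat \<delta>)"

text \<open>
  \<open>P i = Some \<delta>\<close> means that the observer, having seen \<open>a i\<close>, predicts that the sequence will never
  exceed \<open>a i + \<delta>\<close>; \<open>P i = None\<close> means that no prediction is made at that moment.
\<close>

definition observer_wins :: "(nat \<Rightarrow> rat) \<Rightarrow> rat \<Rightarrow> (nat \<Rightarrow> rat option) \<Rightarrow> bool" where
  "observer_wins a \<epsilon> P \<longleftrightarrow>
     (\<forall>i \<delta>. P i = Some \<delta> \<longrightarrow> 0 \<le> \<delta>) \<and>
     (\<exists>i \<delta>. P i = Some \<delta> \<and> (\<forall>j\<ge>i. a j \<le> a i + \<delta>)) \<and>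
     summable (\<lambda>i. prediction_cost (P i)) \<and> (\<Sum>i. prediction_cost (P i)) < of_rat \<epsilon>"

definition history :: "(nat \<Rightarrow> rat) \<Rightarrow> nat \<Rightarrow> rat list" where
  "history a i = map a [0..<Suc i]"

definition computable_winning_strategy ::
    "(nat \<Rightarrow> rat) \<Rightarrow> (rat \<Rightarrow> rat list \<Rightarrow> rat option) \<Rightarrow> bool" where
  "computable_winning_strategy a S \<longleftrightarrow>
     computable_on {(\<epsilon>, h). \<epsilon> > 0 \<and> h \<in> range (history a)} (\<lambda>(\<epsilon>, h). S \<epsilon> h) \<and>
     (\<forall>\<epsilon>>0. observer_wins a \<epsilon> (\<lambda>i. S \<epsilon> (history a i)))"

end

theory Submission
  imports Defs
begin

text \<open>
  A winning strategy yields a test: run it with \<open>\<epsilon> = 1 / 2 ^ Suc n\<close> on the sequence itself and collect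
  the intervals \<open>[a i, a i + \<delta>]\<close> of its predictions, slightly enlarged to make them open; a prediction
  that remains true forever puts \<open>\<alpha>\<close> in its interval.

  Conversely, let \<open>\<alpha>\<close> lie in a union \<open>U\<close> of intervals of measure less than \<open>\<epsilon>\<close>. Whenever
  the sequence exceeds all bounds predicted so far, the observer predicts that it will not exceed the
  largest right endpoint among those of the first \<open>i\<close> intervals that contain \<open>a i\<close>. The predicted
  intervals \<open>[a i, a i + \<delta>)\<close> are disjoint subsets of \<open>U\<close>, so their total length is less than
  \<open>\<epsilon>\<close>. Once the sequence has entered an interval that contains \<open>\<alpha>\<close>, every new prediction is true,
  and if no new one is made, then the last one was true. The strategy needs only the length of the
  history, because the sequence is computable.
\<close>

section \<open>Programs for pairing\<close>

lemma evaluates_Proj: "i < length xs \<Longrightarrow> y = xs ! i \<Longrightarrow> evaluates (Proj i) xs y"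
  by (auto intro: evaluates.proj)

lemma evaluates_Comp1: "evaluates g xs y \<Longrightarrow> evaluates f [y] z \<Longrightarrow> evaluates (Comp f [g]) xs z"
  by (rule evaluates.comp[where ys = "[y]"]) auto

lemma evaluates_Comp2:
  "evaluates g xs y \<Longrightarrow> evaluates g' xs y' \<Longrightarrow> evaluates f [y, y'] z
    \<Longrightarrow> evaluates (Comp f [g, g']) xs z"
  by (rule evaluates.comp[where ys = "[y, y']"]) auto

section \<open>Addition, truncated subtraction and triangular numbers\<close>

definition add_program :: program where
  "add_program = PrimRec (Proj 0) (Comp Succ [Proj (Suc 0)])"

lemma evaluates_add: "evaluates add_program [m, n] (m + n)"
proof (induction m)
  case 0
  then show ?case
    unfolding add_program_def by (auto intro!: evaluates.rec_0 evaluates_Proj)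
next
  case (Suc m)
  then show ?case
    unfolding add_program_def
    by (auto intro!: evaluates.rec_Suc evaluates_Comp1 evaluates.succ evaluates_Proj)
qed

definition pred_program :: program where
  "pred_program = PrimRec Zero (Proj 0)"

lemma evaluates_pred: "evaluates pred_program [n] (n - 1)"
proof (induction n)
  case 0
  then show ?case
    unfolding pred_program_def by (auto intro!: evaluates.rec_0 evaluates.zero)
next
  case (Suc n)
  then show ?case
    unfolding pred_program_def by (auto intro!: evaluates.rec_Suc[OF Suc[unfolded pred_program_def]] evaluates_Proj)
qed

text \<open>\<open>PrimRec\<close> recurses on its first argument, so the subtrahend comes
  first.\<close>

definition sub_program :: program where
  "sub_program = PrimRec (Proj 0) (Comp pred_program [Proj (Suc 0)])"

lemma evaluates_sub: "evaluates sub_program [n, m] (m - n)"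
proof (induction n)
  case 0
  then show ?case
    unfolding sub_program_def by (auto intro!: evaluates.rec_0 evaluates_Proj)
next
  case (Suc n)
  have "evaluates pred_program [m - n] (m - Suc n)"
    using evaluates_pred[of "m - n"] by simp
  then show ?case
    using Suc unfolding sub_program_def
    by (auto intro!: evaluates.rec_Suc[OF Suc[unfolded sub_program_def]] evaluates_Comp1[where y = "m - n"] evaluates_Proj)
qed

definition triangle_program :: program where
  "triangle_program = PrimRec Zero (Comp Succ [Comp add_program [Proj 0, Proj (Suc 0)]])"

lemma evaluates_triangle: "evaluates triangle_program [n] (triangle n)"
proof (induction n)
  case 0
  then show ?case
    unfolding triangle_program_def by (auto intro!: evaluates.rec_0 evaluates.zero)
next
  case (Suc n)
  have "evaluates (Comp Succ [Comp add_program [Proj 0, Proj (Suc 0)]]) [n, triangle n] (Suc (n + triangle n))"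
    by (rule evaluates_Comp1 evaluates_Comp2 evaluates_add evaluates.succ evaluates_Proj | simp)+
  then show ?case
    unfolding triangle_program_def
    by (auto intro!: evaluates.rec_Suc[OF Suc[unfolded triangle_program_def]] simp: add.commute)
qed

text \<open>Cantor pairing: \<open>prod_encode (m, n) = triangle (m + n) + m\<close>.\<close>

definition pair_program :: program where
  "pair_program = Comp add_program [Comp triangle_program [add_program], Proj 0]"

lemma evaluates_pair: "evaluates pair_program [m, n] (prod_encode (m, n))"
  unfolding pair_program_def prod_encode_def
  by (auto intro!: evaluates_Comp2 evaluates_Comp1 evaluates_add evaluates_triangle evaluates_Proj)

text \<open>The code \<open>z\<close> of \<open>(m, n)\<close> lies on the diagonal
  \<open>t = m + n\<close>, which is the least \<open>t\<close> with
  \<open>z < triangle (Suc t)\<close>. The strict inequality is tested as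
  \<open>Suc z - triangle (Suc t) = 0\<close>.\<close>

definition diagonal_program :: program where
  "diagonal_program =
     Minim (Comp sub_program [Comp triangle_program [Comp Succ [Proj 0]], Comp Succ [Proj 1]])"

lemma evaluates_diagonal: "evaluates diagonal_program [prod_encode (m, n)] (m + n)"
proof -
  let ?z = "prod_encode (m, n)"
  have *: "evaluates (Comp sub_program [Comp triangle_program [Comp Succ [Proj 0]], Comp Succ [Proj 1]])
      [t, ?z] (Suc ?z - triangle (Suc t))" for t
    by (rule evaluates_Comp1 evaluates_Comp2 evaluates_sub evaluates_triangle
        evaluates.succ evaluates_Proj | simp)+
  have "Suc ?z - triangle (Suc (m + n)) = 0"
    by (simp add: prod_encode_def)
  moreover have "\<exists>k. Suc ?z - triangle (Suc t) = Suc k" if "t < m + n" for t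
  proof -
    have "triangle (Suc t) \<le> triangle (m + n)"
      using that unfolding triangle_def by (intro div_le_mono mult_le_mono) auto
    then show ?thesis
      unfolding prod_encode_def by (intro exI[of _ "triangle (m + n) + m - triangle (Suc t)"]) simp
  qed
  ultimately show ?thesis
    unfolding diagonal_program_def
    by (intro evaluates.minim allI impI) (use * in metis)+
qed

definition fst_program :: program where
  "fst_program = Comp sub_program [Comp triangle_program [diagonal_program], Proj 0]"

lemma evaluates_fst: "evaluates fst_program [prod_encode (m, n)] m"
proof -
  have "evaluates sub_program [triangle (m + n), prod_encode (m, n)] m"
    using evaluates_sub[of "triangle (m + n)" "prod_encode (m, n)"] by (simp add: prod_encode_def)
  then show ?thesis
    unfolding fst_program_def
    by (rule evaluates_Comp2[rotated 2])
      (auto intro!: evaluates_Comp1 evaluates_diagonal evaluates_triangle evaluates_Proj)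
qed

definition snd_program :: program where
  "snd_program = Comp sub_program [fst_program, diagonal_program]"

lemma evaluates_snd: "evaluates snd_program [prod_encode (m, n)] n"
  unfolding snd_program_def
  using evaluates_sub[of m "m + n"] by (auto intro: evaluates_Comp2 evaluates_fst evaluates_diagonal)


section \<open>Closure properties of computable functions\<close>

lemma computableI: "(\<And>x. evaluates p [encode x] (encode (f x))) \<Longrightarrow> computable f"
  unfolding computable_on_def by auto

lemma computableD: "computable f \<Longrightarrow> \<exists>p. \<forall>x. evaluates p [encode x] (encode (f x))"
  unfolding computable_on_def by auto

text \<open>On \<open>nat\<close>, \<open>encode\<close> is the identity. This reduces computability
  of a function with values in any type to arithmetic on the codes of its values.\<close>

lemma computable_encode_iff: "computable (\<lambda>x. encode (f x)) \<longleftrightarrow> computable f"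
  by (simp add: computable_on_def encode_nat_def)

lemma computable_id: "computable (\<lambda>x. x)"
  by (rule computableI[of "Proj 0"]) (auto intro: evaluates_Proj)

lemma computable_encode: "computable f \<Longrightarrow> computable (\<lambda>x. encode (f x))"
  by (simp add: computable_encode_iff)

text \<open>The partial form serves to run a strategy, whose program is guaranteed to work only for
  positive \<open>\<epsilon>\<close> and on histories of the given sequence.\<close>

lemma computable_on_compose:
  assumes "computable_on D g" and "computable f" and "\<And>x. f x \<in> D"
  shows "computable (\<lambda>x. g (f x))"
proof -
  obtain q where q: "\<And>x. x \<in> D \<Longrightarrow> evaluates q [encode x] (encode (g x))"
    using assms(1) unfolding computable_on_def by auto
  obtain p where p: "\<And>x. evaluates p [encode x] (encode (f x))"
    using computableD[OF assms(2)] by blast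
  show ?thesis
    using p q assms(3) by (intro computableI[of "Comp q [p]"]) (blast intro: evaluates_Comp1)
qed

lemma computable_compose: "computable g \<Longrightarrow> computable f \<Longrightarrow> computable (\<lambda>x. g (f x))"
  by (rule computable_on_compose) auto

lemma computable_const: "computable (\<lambda>x. c)"
proof -
  have "\<exists>p. \<forall>xs. evaluates p xs n" for n
  proof (induction n)
    case 0
    then show ?case by (blast intro: evaluates.zero)
  next
    case (Suc n)
    then show ?case by (blast intro: evaluates_Comp1 evaluates.succ)
  qed
  then obtain p where "\<And>xs. evaluates p xs (encode c)"
    by blast
  then show ?thesis
    by (intro computableI[of p])
qed

lemma computable_Suc: "computable f \<Longrightarrow> computable (\<lambda>x. Suc (f x))"
  by (rule computable_compose[of Suc], rule computableI[of Succ])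
    (auto simp: encode_nat_def intro: evaluates.succ)

lemma computable_Pair:
  assumes "computable f" and "computable g"
  shows "computable (\<lambda>x. (f x, g x))"
proof -
  obtain p where p: "\<And>x. evaluates p [encode x] (encode (f x))"
    using computableD[OF assms(1)] by blast
  obtain q where q: "\<And>x. evaluates q [encode x] (encode (g x))"
    using computableD[OF assms(2)] by blast
  show ?thesis
    by (rule computableI[of "Comp pair_program [p, q]"])
      (auto simp: encode_prod_def intro: evaluates_Comp2 p q evaluates_pair)
qed

lemma computable_fst: "computable f \<Longrightarrow> computable (\<lambda>x. fst (f x))"
  by (rule computable_compose[of fst], rule computableI[of fst_program])
    (auto simp: encode_prod_def intro: evaluates_fst)

lemma computable_snd: "computable f \<Longrightarrow> computable (\<lambda>x. snd (f x))"
  by (rule computable_compose[of snd], rule computableI[of snd_program])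
    (auto simp: encode_prod_def intro: evaluates_snd)

lemma computable_curry:
  assumes "computable (\<lambda>(u, v). F u v)" and "computable f" and "computable g"
  shows "computable (\<lambda>x. F (f x) (g x))"
  using computable_compose[OF assms(1) computable_Pair[OF assms(2,3)]] by simp

text \<open>The parameter \<open>x\<close> and the accumulator both travel as codes.
  \<open>PrimRec\<close> hands its step the list \<open>[n, encode y, encode x]\<close>, which
  \<open>?step\<close> repacks into the code of the single triple \<open>(x, n, y)\<close>.\<close>

lemma computable_rec_nat:
  assumes "computable g"
    and "computable (\<lambda>z. h (fst z) (fst (snd z)) (snd (snd z)))"
    and "computable m"
  shows "computable (\<lambda>x. rec_nat (g x) (\<lambda>n y. h x n y) (m x))"
proof -
  obtain p where p: "\<And>x. evaluates p [encode x] (encode (g x))"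
    using computableD[OF assms(1)] by blast
  obtain q where "\<And>z. evaluates q [encode z] (encode (h (fst z) (fst (snd z)) (snd (snd z))))"
    using computableD[OF assms(2)] by blast
  from this[of "(_, _, _)"] have q: "evaluates q [encode (x, n, y)] (encode (h x n y))" for x n y
    by simp
  obtain r where "\<And>x. evaluates r [encode x] (encode (m x))"
    using computableD[OF assms(3)] by blast
  then have r: "evaluates r [encode x] (m x)" for x
    by (simp add: encode_nat_def)
  let ?step = "Comp q [Comp pair_program [Proj 2, Comp pair_program [Proj 0, Proj 1]]]"
  have step: "evaluates ?step [n, encode y, encode x] (encode (h x n y))" for x n y
  proof (rule evaluates_Comp1)
    show "evaluates q [encode (x, n, y)] (encode (h x n y))" by (rule q)
    show "evaluates (Comp pair_program [Proj 2, Comp pair_program [Proj 0, Proj 1]])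
        [n, encode y, encode x] (encode (x, n, y))"
      by (auto simp: encode_prod_def encode_nat_def
          intro!: evaluates_Comp2 evaluates_pair evaluates_Proj)
  qed
  have "evaluates (PrimRec p ?step) [n, encode x] (encode (rec_nat (g x) (h x) n))" for n x
  proof (induction n)
    case 0
    then show ?case by (auto intro: evaluates.rec_0 p)
  next
    case (Suc n)
    then show ?case using step by (auto intro: evaluates.rec_Suc)
  qed
  then show ?thesis
    by (intro computableI[of "Comp (PrimRec p ?step) [r, Proj 0]"])
      (auto intro: evaluates_Comp2 r evaluates_Proj)
qed

section \<open>Decidable predicates, case distinction and unbounded search\<close>

definition decidable :: "('a::encodable \<Rightarrow> bool) \<Rightarrow> bool" where
  "decidable P \<longleftrightarrow> computable (\<lambda>x. of_bool (P x) :: nat)"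

text \<open>A recursion with zero or one step: it starts from \<open>g x\<close>, and its only
  possible step overwrites this by \<open>f x\<close>.\<close>

lemma computable_If:
  assumes "decidable P" and "computable f" and "computable g"
  shows "computable (\<lambda>x. if P x then f x else g x)"
proof -
  have "computable (\<lambda>x. rec_nat (g x) (\<lambda>_ _. f x) (of_bool (P x)))"
    by (intro computable_rec_nat computable_compose[OF assms(2)] computable_fst computable_id
        assms(1)[unfolded decidable_def] assms(3))
  moreover have "(\<lambda>x. rec_nat (g x) (\<lambda>_ _. f x) (of_bool (P x))) = (\<lambda>x. if P x then f x else g x)"
    by auto
  ultimately show ?thesis by simp
qed

lemma decidable_eq_0:
  fixes f :: "'a::encodable \<Rightarrow> nat"
  assumes "computable f"
  shows "decidable (\<lambda>x. f x = 0)"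
proof -
  have "computable (\<lambda>x. rec_nat 1 (\<lambda>_ _. 0 :: nat) (f x))"
    using assms by (intro computable_rec_nat computable_const)
  moreover have "(\<lambda>x. rec_nat 1 (\<lambda>_ _. 0 :: nat) (f x)) = (\<lambda>x. of_bool (f x = 0))"
    by (rule ext) (auto simp: gr0_conv_Suc)
  ultimately show ?thesis by (simp add: decidable_def)
qed

lemma decidable_not: "decidable P \<Longrightarrow> decidable (\<lambda>x. \<not> P x)"
  using decidable_eq_0[of "\<lambda>x. of_bool (P x)"] by (simp add: decidable_def)

lemma decidable_If:
  "decidable P \<Longrightarrow> decidable Q \<Longrightarrow> decidable R \<Longrightarrow> decidable (\<lambda>x. if P x then Q x else R x)"
  unfolding decidable_def if_distrib[of of_bool]
  by (rule computable_If) (auto simp: decidable_def)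

lemma decidable_const: "decidable (\<lambda>x. c)"
  unfolding decidable_def by (rule computable_const)

lemma decidable_conj:
  assumes "decidable P" and "decidable Q"
  shows "decidable (\<lambda>x. P x \<and> Q x)"
proof -
  have "decidable (\<lambda>x. if P x then Q x else False)"
    by (intro decidable_If decidable_const assms)
  moreover have "(\<lambda>x. if P x then Q x else False) = (\<lambda>x. P x \<and> Q x)"
    by auto
  ultimately show ?thesis by (simp only:)
qed

text \<open>\<open>Minim\<close> looks for a zero, hence the test of the negation: its value is 0
  once \<open>P x n\<close> holds and 1 at all earlier numbers, as the rule \<open>minim\<close>
  demands.\<close>

lemma computable_Least:
  fixes P :: "'a::encodable \<Rightarrow> nat \<Rightarrow> bool"
  assumes "decidable (\<lambda>z. P (fst z) (snd z))" and "\<And>x. \<exists>n. P x n"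
  shows "computable (\<lambda>x. LEAST n. P x n)"
proof -
  obtain q where "\<And>z. evaluates q [encode z] (encode (of_bool (\<not> P (fst z) (snd z)) :: nat))"
    using computableD[OF decidable_not[OF assms(1), unfolded decidable_def]] by blast
  from this[of "(_, _)"] have q: "evaluates q [encode (x, n)] (of_bool (\<not> P x n))" for x n
    by (simp add: encode_nat_def)
  let ?p = "Comp q [Comp pair_program [Proj 1, Proj 0]]"
  have *: "evaluates ?p [n, encode x] (of_bool (\<not> P x n))" for x n
  proof (rule evaluates_Comp1)
    show "evaluates q [encode (x, n)] (of_bool (\<not> P x n))" by (rule q)
    show "evaluates (Comp pair_program [Proj 1, Proj 0]) [n, encode x] (encode (x, n))"
      by (auto simp: encode_prod_def encode_nat_def
          intro!: evaluates_Comp2 evaluates_pair evaluates_Proj)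
  qed
  have "evaluates (Minim ?p) [encode x] (LEAST n. P x n)" for x
  proof (rule evaluates.minim)
    show "evaluates ?p [LEAST n. P x n, encode x] 0"
      using *[of "LEAST n. P x n" x] LeastI_ex[OF assms(2)[of x]] by simp
    have "evaluates ?p [m, encode x] (Suc 0)" if "m < (LEAST n. P x n)" for m
      using *[of m x] not_less_Least[OF that] by simp
    then show "\<forall>m<(LEAST n. P x n). \<exists>k. evaluates ?p [m, encode x] (Suc k)"
      by blast
  qed
  then show ?thesis
    by (intro computableI[of "Minim ?p"]) (simp add: encode_nat_def)
qed

section \<open>Arithmetic and order on the natural numbers\<close>

lemma computable_add_nat:
  fixes f g :: "'a::encodable \<Rightarrow> nat"
  assumes "computable f" and "computable g"
  shows "computable (\<lambda>x. f x + g x)"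
proof -
  have "rec_nat m (\<lambda>_ y. Suc y) n = m + n" for m n :: nat
    by (induction n) auto
  moreover have "computable (\<lambda>x. rec_nat (f x) (\<lambda>_ y. Suc y) (g x))"
    by (intro computable_rec_nat computable_Suc computable_snd computable_id assms)
  ultimately show ?thesis by simp
qed

lemma computable_mult_nat:
  fixes f g :: "'a::encodable \<Rightarrow> nat"
  assumes "computable f" and "computable g"
  shows "computable (\<lambda>x. f x * g x)"
proof -
  have "rec_nat 0 (\<lambda>_ y. y + m) n = m * n" for m n :: nat
    by (induction n) auto
  moreover have "computable (\<lambda>x. rec_nat 0 (\<lambda>_ y. y + f x) (g x))"
    by (intro computable_rec_nat computable_add_nat computable_snd computable_id
        computable_compose[OF assms(1)] computable_fst computable_const assms(2))
  ultimately show ?thesis by simp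
qed

lemma computable_diff_nat:
  fixes f g :: "'a::encodable \<Rightarrow> nat"
  assumes "computable f" and "computable g"
  shows "computable (\<lambda>x. f x - g x)"
proof -
  \<comment> \<open>The predecessor is a recursion whose step returns its own counter.\<close>
  have pred: "rec_nat 0 (\<lambda>k _. k) n = n - 1" for n :: nat
    by (cases n) auto
  have "computable (\<lambda>x. rec_nat 0 (\<lambda>k _. k) (h x))" if "computable h" for h :: "'b::encodable \<Rightarrow> nat"
    by (intro computable_rec_nat computable_fst computable_snd computable_id computable_const that)
  then have comp_pred: "computable (\<lambda>x. h x - 1)" if "computable h" for h :: "'b::encodable \<Rightarrow> nat"
    using that unfolding pred by simp
  have "rec_nat m (\<lambda>_ y. y - 1) n = m - n" for m n :: nat
    by (induction n) auto
  moreover have "computable (\<lambda>x. rec_nat (f x) (\<lambda>_ y. y - 1) (g x))"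
    by (intro computable_rec_nat comp_pred computable_snd computable_id assms)
  ultimately show ?thesis by simp
qed

lemma computable_power_nat:
  fixes f :: "'a::encodable \<Rightarrow> nat"
  assumes "computable f"
  shows "computable (\<lambda>x. c ^ f x :: nat)"
proof -
  have "rec_nat 1 (\<lambda>_ y. c * y) n = c ^ n" for n :: nat
    by (induction n) auto
  moreover have "computable (\<lambda>x. rec_nat 1 (\<lambda>_ y. c * y) (f x))"
    by (intro computable_rec_nat computable_mult_nat computable_snd computable_id computable_const assms)
  ultimately show ?thesis by simp
qed

lemma decidable_le_nat:
  fixes f g :: "'a::encodable \<Rightarrow> nat"
  shows "computable f \<Longrightarrow> computable g \<Longrightarrow> decidable (\<lambda>x. f x \<le> g x)"
  using decidable_eq_0[OF computable_diff_nat, of f g] by simp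

lemma decidable_less_nat:
  fixes f g :: "'a::encodable \<Rightarrow> nat"
  shows "computable f \<Longrightarrow> computable g \<Longrightarrow> decidable (\<lambda>x. f x < g x)"
  using decidable_not[OF decidable_le_nat, of g f] by (simp add: not_le)

lemma computable_div_nat:
  fixes f g :: "'a::encodable \<Rightarrow> nat"
  assumes "computable f" and "computable g"
  shows "computable (\<lambda>x. f x div g x)"
proof -
  have least: "(LEAST q. m < Suc q * n) = m div n" if "n \<noteq> 0" for m n :: nat
  proof (rule Least_equality)
    show "m < Suc (m div n) * n"
      using that dividend_less_div_times[of n m] by simp
    show "m div n \<le> q" if "m < Suc q * n" for q
      using that less_mult_imp_div_less[of m "Suc q" n] by simp
  qed
  \<comment> \<open>With divisor 0 the search would never end. It runs with divisor 1 instead, and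
    the value 0 of \<open>div\<close> is put in afterwards.\<close>
  let ?h = "\<lambda>x. if g x = 0 then 1 else g x"
  have h: "computable ?h"
    by (intro computable_If decidable_eq_0 computable_const assms)
  have "\<exists>q. f x < Suc q * ?h x" for x
    by (intro exI[of _ "f x"]) (cases "g x"; simp)
  then have "computable (\<lambda>x. LEAST q. f x < Suc q * ?h x)"
    by (intro computable_Least decidable_less_nat computable_mult_nat computable_Suc
        computable_snd computable_id computable_compose[OF assms(1)] computable_compose[OF h] computable_fst)
  then have "computable (\<lambda>x. if g x = 0 then 0 else (LEAST q. f x < Suc q * ?h x))"
    by (intro computable_If decidable_eq_0 computable_const assms)
  moreover have "(\<lambda>x. if g x = 0 then 0 else (LEAST q. f x < Suc q * ?h x)) = (\<lambda>x. f x div g x)"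
    by (auto simp: fun_eq_iff least simp del: mult_Suc)
  ultimately show ?thesis by simp
qed

lemma decidable_dvd_nat:
  fixes f g :: "'a::encodable \<Rightarrow> nat"
  assumes "computable f" and "computable g"
  shows "decidable (\<lambda>x. f x dvd g x)"
proof -
  have "decidable (\<lambda>x. g x - g x div f x * f x = 0)"
    by (intro decidable_eq_0 computable_diff_nat computable_mult_nat computable_div_nat assms)
  moreover have "g x - g x div f x * f x = 0 \<longleftrightarrow> f x dvd g x" for x
    by (simp add: minus_div_mult_eq_mod dvd_eq_mod_eq_0)
  ultimately show ?thesis by simp
qed

text \<open>A search for a least number finds the greatest common divisor by counting its distance
  \<open>k\<close> down from \<open>n\<close>. Positivity of \<open>n\<close> excludes the candidate
  0, which divides only 0.\<close>

lemma computable_gcd_nat: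
  fixes f g :: "'a::encodable \<Rightarrow> nat"
  assumes "computable f" and "computable g" and "\<And>x. g x > 0"
  shows "computable (\<lambda>x. gcd (f x) (g x))"
proof -
  have eq: "n - (LEAST k. n - k dvd m \<and> n - k dvd n) = gcd m n" if "n > 0" for m n :: nat
  proof -
    have le: "gcd m n \<le> n"
      using that by (simp add: dvd_imp_le)
    have "(LEAST k. n - k dvd m \<and> n - k dvd n) = n - gcd m n"
    proof (rule Least_equality)
      show "n - (n - gcd m n) dvd m \<and> n - (n - gcd m n) dvd n"
        using le by simp
      fix k
      assume "n - k dvd m \<and> n - k dvd n"
      then have "n - k \<le> gcd m n"
        using that by (intro dvd_imp_le gcd_greatest) auto
      then show "n - gcd m n \<le> k" by simp
    qed
    then show ?thesis using le by simp
  qed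
  have "\<exists>k. g x - k dvd f x \<and> g x - k dvd g x" for x
    by (rule exI[of _ "g x - gcd (f x) (g x)"]) (simp add: assms(3) gcd_le2_nat)
  then have "computable (\<lambda>x. g x - (LEAST k. g x - k dvd f x \<and> g x - k dvd g x))"
    by (intro computable_diff_nat computable_Least decidable_conj decidable_dvd_nat
        computable_compose[OF assms(1)] computable_compose[OF assms(2)] computable_fst
        computable_snd computable_id assms(1,2))
  then show ?thesis
    by (simp add: eq assms(3))
qed


section \<open>Computable rational arithmetic\<close>

text \<open>
  A rational is split into natural numbers, \<open>r = (rat_pos r - rat_neg r) / rat_den r\<close>, which reduces its
  arithmetic to that of \<open>nat\<close>; only the return to lowest terms needs a gcd.
\<close>

definition rat_pos :: "rat \<Rightarrow> nat" where "rat_pos r = nat (fst (quotient_of r))"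
definition rat_neg :: "rat \<Rightarrow> nat" where "rat_neg r = nat (- fst (quotient_of r))"
definition rat_den :: "rat \<Rightarrow> nat" where "rat_den r = nat (snd (quotient_of r))"

lemma rat_den_pos: "0 < rat_den r"
  by (simp add: rat_den_def quotient_of_denom_pos')

lemma rat_eq_quotient: "r = (of_nat (rat_pos r) - of_nat (rat_neg r)) / of_nat (rat_den r)"
proof -
  have "(of_nat (nat i) - of_nat (nat (- i)) :: rat) = of_int i" for i
    by (cases "0 \<le> i") auto
  moreover have "(of_nat (rat_den r) :: rat) = of_int (snd (quotient_of r))"
    using quotient_of_denom_pos'[of r] by (simp add: rat_den_def)
  ultimately show ?thesis
    using quotient_of_div[of r "fst (quotient_of r)" "snd (quotient_of r)"]
    by (simp add: rat_pos_def rat_neg_def)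
qed

section \<open>Numerators and denominators from codes\<close>

lemma int_encode_of_nat: "int_encode (int n) = 2 * n"
  by (simp add: int_encode_def sum_encode_def)

lemma int_encode_neg_of_nat: "0 < n \<Longrightarrow> int_encode (- int n) = 2 * n - 1"
  by (auto simp: int_encode_def sum_encode_def nat_diff_distrib' of_nat_diff)

text \<open>\<open>int_encode\<close> gives the nonnegative integers even codes and the negative
  ones odd codes, so parity decides the sign.\<close>

lemma nat_int_encode: "nat i = (if 2 dvd int_encode i then int_encode i div 2 else 0)"
  by (cases "0 \<le> i") (auto simp: int_encode_def sum_encode_def)

lemma nat_neg_int_encode: "nat (- i) = (if 2 dvd int_encode i then 0 else Suc (int_encode i) div 2)"
  by (cases "0 \<le> i") (auto simp: int_encode_def sum_encode_def)

text \<open>The code of a rational is by definition the code of this pair, so the identity program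
  suffices.\<close>

lemma computable_quotient_of:
  "computable (\<lambda>r. (int_encode (fst (quotient_of r)), int_encode (snd (quotient_of r))))"
  by (rule computableI[of "Proj 0"])
    (auto simp: encode_prod_def encode_rat_def encode_nat_def intro: evaluates_Proj)

lemmas computable_num_code = computable_fst[OF computable_quotient_of, simplified]
lemmas computable_den_code = computable_snd[OF computable_quotient_of, simplified]

lemma computable_rat_pos:
  assumes "computable f"
  shows "computable (\<lambda>x. rat_pos (f x))"
proof (rule computable_compose[OF _ assms])
  show "computable rat_pos"
    unfolding rat_pos_def[abs_def] nat_int_encode
    by (intro computable_If decidable_dvd_nat computable_const computable_div_nat computable_Suc
        computable_num_code)
qed

lemma computable_rat_neg:
  assumes "computable f"
  shows "computable (\<lambda>x. rat_neg (f x))"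
proof (rule computable_compose[OF _ assms])
  show "computable rat_neg"
    unfolding rat_neg_def[abs_def] nat_neg_int_encode
    by (intro computable_If decidable_dvd_nat computable_const computable_div_nat computable_Suc
        computable_num_code)
qed

lemma computable_rat_den:
  assumes "computable f"
  shows "computable (\<lambda>x. rat_den (f x))"
proof (rule computable_compose[OF _ assms])
  show "computable rat_den"
    unfolding rat_den_def[abs_def] nat_int_encode
    by (intro computable_If decidable_dvd_nat computable_const computable_div_nat computable_Suc
        computable_den_code)
qed

section \<open>Quotients in lowest terms\<close>

lemma quotient_of_divide:
  assumes "0 < d"
  shows "quotient_of (of_int i / of_nat d) = (i div gcd i (int d), int d div gcd i (int d))"
proof -
  have "(of_int i / of_nat d :: rat) = Fract i (int d)"
    by (simp add: Fract_of_int_quotient)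
  then show ?thesis
    using assms by (simp add: quotient_of_Fract Rat.normalize_def Let_def)
qed

text \<open>The right-hand side uses operations on \<open>nat\<close> alone, so that the closure
  rules apply to it. Since subtraction is truncated, \<open>(u - v) + (v - u)\<close> is the
  absolute difference; the two branches are the even and odd codes of the reduced numerator.\<close>

lemma encode_rat_divide:
  fixes u v d :: nat
  assumes "0 < d"
  defines "g \<equiv> gcd ((u - v) + (v - u)) d"
  shows "encode ((of_nat u - of_nat v) / of_nat d :: rat) =
    encode (if v \<le> u then 2 * ((u - v) div g) else 2 * ((v - u) div g) - 1, 2 * (d div g))"
proof (cases "v \<le> u")
  case True
  then have diff: "(of_nat u - of_nat v :: rat) = of_int (int (u - v))"
    by (simp add: of_nat_diff)
  have g: "gcd (int (u - v)) (int d) = int g"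
    unfolding gcd_int_int_eq using True by (simp add: g_def)
  have "quotient_of ((of_nat u - of_nat v) / of_nat d) = (int ((u - v) div g), int (d div g))"
    by (simp only: diff quotient_of_divide[OF assms(1)] g zdiv_int)
  then show ?thesis
    using True by (simp add: encode_rat_def encode_prod_def encode_nat_def int_encode_of_nat)
next
  case False
  then have diff: "(of_nat u - of_nat v :: rat) = of_int (- int (v - u))"
    by (simp add: of_nat_diff)
  have g: "gcd (- int (v - u)) (int d) = int g"
    unfolding gcd_neg1_int gcd_int_int_eq using False by (simp add: g_def)
  have "g dvd v - u" and "0 < g"
    using False assms(1) by (simp_all add: g_def)
  then obtain k where k: "v - u = g * k"
    by (auto elim: dvdE)
  with False have "0 < k"
    by (cases k) auto
  \<comment> \<open>\<open>div\<close> on \<open>int\<close> rounds down; the sign can be pulled out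
    because \<open>g\<close> divides \<open>v - u\<close> exactly.\<close>
  have "- int (v - u) div int g = - int k"
    using \<open>0 < g\<close> by (simp add: k flip: mult_minus_right)
  then have "quotient_of ((of_nat u - of_nat v) / of_nat d) = (- int k, int (d div g))"
    by (simp only: diff quotient_of_divide[OF assms(1)] g zdiv_int)
  then show ?thesis
    using False \<open>0 < g\<close> \<open>0 < k\<close>
    by (simp add: k encode_rat_def encode_prod_def encode_nat_def int_encode_of_nat
        int_encode_neg_of_nat)
qed

lemma computable_rat_divide:
  fixes u v d :: "'a::encodable \<Rightarrow> nat"
  assumes "computable u" and "computable v" and "computable d" and "\<And>x. 0 < d x"
  shows "computable (\<lambda>x. (of_nat (u x) - of_nat (v x)) / of_nat (d x) :: rat)"
  by (subst computable_encode_iff[symmetric], subst encode_rat_divide, rule assms(4),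
      intro computable_encode computable_Pair computable_If computable_mult_nat computable_const
      computable_div_nat computable_diff_nat computable_gcd_nat computable_add_nat
      decidable_le_nat assms)

section \<open>Arithmetic and order on the rationals\<close>

lemma computable_add_rat:
  fixes f g :: "'a::encodable \<Rightarrow> rat"
  assumes "computable f" and "computable g"
  shows "computable (\<lambda>x. f x + g x)"
proof -
  have "r + s = (of_nat (rat_pos r * rat_den s + rat_pos s * rat_den r)
      - of_nat (rat_neg r * rat_den s + rat_neg s * rat_den r)) / of_nat (rat_den r * rat_den s)" for r s
    by (subst (1) rat_eq_quotient[of r], subst (1) rat_eq_quotient[of s])
      (use rat_den_pos[of r] rat_den_pos[of s] in \<open>simp add: field_simps\<close>)
  then show ?thesis
    by (simp only: assms rat_den_pos computable_rat_divide computable_add_nat computable_mult_nat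
        computable_rat_pos computable_rat_neg computable_rat_den mult_pos_pos)
qed

lemma computable_diff_rat:
  fixes f g :: "'a::encodable \<Rightarrow> rat"
  assumes "computable f" and "computable g"
  shows "computable (\<lambda>x. f x - g x)"
proof -
  \<comment> \<open>Negation exchanges the positive and the negative part.\<close>
  have "- r = (of_nat (rat_neg r) - of_nat (rat_pos r)) / of_nat (rat_den r)" for r
    by (subst (1) rat_eq_quotient[of r]) (metis minus_diff_eq minus_divide_left)
  then have "computable (\<lambda>x. - g x)"
    by (simp only: assms rat_den_pos computable_rat_divide
        computable_rat_pos computable_rat_neg computable_rat_den)
  from computable_add_rat[OF assms(1) this] show ?thesis by simp
qed

lemma decidable_less_rat:
  fixes f g :: "'a::encodable \<Rightarrow> rat"
  assumes "computable f" and "computable g"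
  shows "decidable (\<lambda>x. f x < g x)"
proof -
  \<comment> \<open>Cross-multiplication by the positive denominators, with each negative part moved
    to the other side, leaves only sums and products of naturals.\<close>
  have "r < s \<longleftrightarrow> rat_pos r * rat_den s + rat_neg s * rat_den r
      < rat_pos s * rat_den r + rat_neg r * rat_den s" for r s
  proof -
    have "r < s \<longleftrightarrow> (of_nat (rat_pos r) - of_nat (rat_neg r)) * (of_nat (rat_den s) :: rat)
        < (of_nat (rat_pos s) - of_nat (rat_neg s)) * of_nat (rat_den r)"
      by (subst (1) rat_eq_quotient[of r], subst (1) rat_eq_quotient[of s])
        (use rat_den_pos[of r] rat_den_pos[of s] in \<open>simp add: field_simps\<close>)
    also have "\<dots> \<longleftrightarrow> (of_nat (rat_pos r * rat_den s + rat_neg s * rat_den r) :: rat)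
        < of_nat (rat_pos s * rat_den r + rat_neg r * rat_den s)"
      by (simp add: algebra_simps del: of_nat_less_iff)
    finally show ?thesis by (simp only: of_nat_less_iff)
  qed
  then show ?thesis
    by (simp only: assms decidable_less_nat computable_add_nat computable_mult_nat
        computable_rat_pos computable_rat_neg computable_rat_den)
qed

lemma computable_inverse_power2:
  assumes "computable m"
  shows "computable (\<lambda>x. 1 / 2 ^ m x :: rat)"
  using computable_rat_divide[OF computable_const[of 1] computable_const[of 0]
      computable_power_nat[OF assms, of 2]] by simp


section \<open>Computable functions on options and lists\<close>

lemma computable_Some: "computable f \<Longrightarrow> computable (\<lambda>x. Some (f x))"
  by (subst computable_encode_iff[symmetric])
    (simp add: encode_option_def computable_Suc computable_encode)

lemma computable_case_option_const:
  fixes f :: "'a::encodable \<Rightarrow> 'b::encodable option"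
  assumes "computable f"
  shows "computable (\<lambda>x. case f x of None \<Rightarrow> c | Some y \<Rightarrow> y)"
proof -
  have "computable (\<lambda>x. if encode (f x) = 0 then encode c else encode (f x) - 1)"
    by (intro computable_If decidable_eq_0 computable_const computable_diff_nat computable_encode assms)
  moreover have "(\<lambda>x. if encode (f x) = 0 then encode c else encode (f x) - 1)
      = (\<lambda>x. encode (case f x of None \<Rightarrow> c | Some y \<Rightarrow> y))"
    by (auto simp: encode_option_def fun_eq_iff split: option.splits)
  ultimately show ?thesis
    by (simp only: computable_encode_iff)
qed

section \<open>Lists and histories\<close>

lemma encode_Nil: "encode [] = 0"
  by (simp add: encode_list_def)

lemma encode_Cons: "encode (x # xs) = Suc (encode (encode x, encode xs))"
  by (simp add: encode_list_def encode_prod_def encode_nat_def)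

lemma computable_Cons:
  "computable f \<Longrightarrow> computable g \<Longrightarrow> computable (\<lambda>x. f x # g x)"
  by (subst computable_encode_iff[symmetric])
    (simp only: encode_Cons computable_Suc computable_Pair computable_encode)

lemma computable_snd_prod_decode: "computable (\<lambda>n. snd (prod_decode n))"
proof (rule computableI[of snd_program])
  fix n
  show "evaluates snd_program [encode n] (encode (snd (prod_decode n)))"
    using evaluates_snd[of "fst (prod_decode n)" "snd (prod_decode n)"]
    by (simp add: encode_nat_def)
qed

lemma computable_tl:
  assumes "computable f"
  shows "computable (\<lambda>x. tl (f x))"
proof -
  have "computable (\<lambda>x. if encode (f x) = 0 then 0 else snd (prod_decode (encode (f x) - 1)))"
    by (intro computable_If decidable_eq_0 computable_const computable_diff_nat computable_encode
        computable_compose[OF computable_snd_prod_decode] assms)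
  moreover have "(if encode xs = 0 then 0 else snd (prod_decode (encode xs - 1))) = encode (tl xs)"
    for xs :: "'b list"
    by (cases xs) (simp_all add: encode_Nil encode_Cons, simp add: encode_prod_def encode_nat_def)
  ultimately show ?thesis
    by (simp only: computable_encode_iff)
qed

text \<open>The length is the least number of applications of \<open>tl\<close> that lead to the
  empty list, the only list with code 0.\<close>

lemma computable_length:
  assumes "computable f"
  shows "computable (\<lambda>x. length (f x))"
proof -
  have drop: "rec_nat xs (\<lambda>_. tl) n = drop n xs" for xs :: "'b list" and n
    by (induction n) (simp_all add: drop_Suc tl_drop)
  have "encode (drop n xs) = 0 \<longleftrightarrow> length xs \<le> n" for xs :: "'b list" and n
    by (cases "drop n xs") (auto simp: encode_Nil encode_Cons dest: arg_cong[where f = length])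
  then have least: "length xs = (LEAST n. encode (rec_nat xs (\<lambda>_. tl) n) = 0)" for xs :: "'b list"
    unfolding drop by (intro Least_equality[symmetric]) (simp_all add: encode_Nil)
  have "\<exists>n. encode (rec_nat xs (\<lambda>_. tl) n) = 0" for xs :: "'b list"
    by (rule exI[of _ "length xs"]) (simp add: drop encode_Nil)
  then have "computable (\<lambda>xs :: 'b list. LEAST n. encode (rec_nat xs (\<lambda>_. tl) n) = 0)"
    by (intro computable_Least decidable_eq_0 computable_encode computable_rec_nat computable_tl
        computable_fst computable_snd computable_id)
  then have "computable (length :: 'b list \<Rightarrow> nat)"
    by (simp only: least[abs_def])
  then show ?thesis
    using assms by (rule computable_compose)
qed

lemma computable_history:
  assumes "computable a" and "computable f"
  shows "computable (\<lambda>x. history a (f x))"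
proof -
  \<comment> \<open>The list is built by \<open>#\<close> from its last entry backwards: after
    \<open>m\<close> steps it holds the last \<open>m\<close> terms of the history.\<close>
  have eq: "rec_nat [] (\<lambda>m ys. a (i - m) # ys) m = map a [Suc i - m..<Suc i]" if "m \<le> Suc i" for m i
    using that
  proof (induction m)
    case 0
    show ?case by simp
  next
    case (Suc m)
    then have "[Suc i - Suc m..<Suc i] = (i - m) # [Suc i - m..<Suc i]"
      by (simp add: upt_conv_Cons Suc_diff_le del: upt_Suc)
    with Suc show ?case by (simp del: upt_Suc)
  qed
  have "history a i = rec_nat [] (\<lambda>m ys. a (i - m) # ys) (Suc i)" for i
    using eq[OF order_refl, of i] by (simp only: history_def diff_self_eq_0)
  moreover have "computable (\<lambda>x. rec_nat [] (\<lambda>m ys. a (f x - m) # ys) (Suc (f x)))"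
    by (intro computable_rec_nat computable_const computable_Suc computable_Cons
        computable_compose[OF assms(1)] computable_diff_nat computable_compose[OF assms(2)]
        computable_fst computable_snd computable_id assms(2))
  ultimately show ?thesis by simp
qed

section \<open>From a winning strategy to a test\<close>

lemma suminf_ennreal_sums:
  fixes f :: "nat \<Rightarrow> real"
  assumes "\<And>i. 0 \<le> f i" and "f sums s"
  shows "(\<Sum>i. ennreal (f i)) = ennreal s"
  using assms suminf_ennreal_eq by blast

lemma prediction_cost_nonneg:
  "observer_wins a \<epsilon> P \<Longrightarrow> 0 \<le> prediction_cost (P i)"
  by (auto simp: observer_wins_def prediction_cost_def split: option.splits)

lemma not_random_if_strategy:
  fixes a :: "nat \<Rightarrow> rat"
  assumes "computable a" and "incseq a" and lim: "(\<lambda>i. of_rat (a i)) \<longlonglongrightarrow> \<alpha>"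
    and S: "computable_winning_strategy a S"
  shows "\<not> martin_loef_random \<alpha>"
proof -
  \<comment> \<open>Half of the measure \<open>1 / 2 ^ n\<close> is reserved for the predictions and
    the other half for the enlargements: \<open>2 * \<eta> n k\<close> sums over \<open>k\<close> to
    \<open>1 / 2 ^ Suc n\<close>.\<close>
  define P where "P n i = S (1 / 2 ^ Suc n) (history a i)" for n i
  define \<eta> :: "nat \<Rightarrow> nat \<Rightarrow> rat" where "\<eta> n k = 1 / 2 ^ (n + 3 + k)" for n k
  \<comment> \<open>A moment without a prediction gets cost 0; its interval then has only the length
    \<open>2 * \<eta> n k\<close>, which the second half already pays for.\<close>
  define cost where "cost n k = (case P n k of None \<Rightarrow> 0 | Some \<delta> \<Rightarrow> \<delta>)" for n k
  define V where "V n k = (a k - \<eta> n k, a k + cost n k + \<eta> n k)" for n k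

  have wins: "observer_wins a (1 / 2 ^ Suc n) (P n)" for n
    using S unfolding computable_winning_strategy_def P_def[abs_def] by simp
  have of_rat_cost: "of_rat (cost n k) = prediction_cost (P n k)" for n k
    by (simp add: cost_def prediction_cost_def split: option.splits)
  have of_rat_\<eta>: "(of_rat (\<eta> n k) :: real) = (1 / 2 ^ (n + 2)) * (1 / 2) ^ Suc k" for n k
    by (simp add: \<eta>_def of_rat_divide of_rat_mult of_rat_power power_add power_one_over)

  have comp_S: "computable_on {(\<epsilon>, h). \<epsilon> > 0 \<and> h \<in> range (history a)} (\<lambda>(\<epsilon>, h). S \<epsilon> h)"
    using S by (simp add: computable_winning_strategy_def)
  \<comment> \<open>These inputs lie in the domain on which the program of the strategy is
    guaranteed to work, so the composition is total.\<close>
  have "computable (\<lambda>x. (1 / 2 ^ Suc (fst x) :: rat, history a (snd x :: nat)))"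
    by (intro computable_Pair computable_inverse_power2 computable_history computable_Suc
        computable_fst computable_snd computable_id assms(1))
  from computable_on_compose[OF comp_S this] have "computable (\<lambda>x. P (fst x) (snd x))"
    by (simp add: P_def case_prod_beta)
  then have "computable (\<lambda>x. V (fst x) (snd x))"
    unfolding V_def cost_def \<eta>_def
    by (intro computable_Pair computable_diff_rat computable_add_rat computable_inverse_power2
        computable_case_option_const computable_add_nat computable_const computable_fst
        computable_snd computable_id computable_compose[OF assms(1)])
  then have "computable (\<lambda>(n, k). V n k)"
    by (simp only: case_prod_unfold)
  moreover have "emeasure lborel (test_set V n) \<le> ennreal (1 / 2 ^ n)" for n
  proof -
    let ?I = "\<lambda>k. {real_of_rat (fst (V n k)) <..< of_rat (snd (V n k))}"
    let ?c = "\<lambda>k. prediction_cost (P n k)"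
    let ?l = "\<lambda>k. ?c k + 2 * of_rat (\<eta> n k)"
    have nonneg: "0 \<le> ?l k" for k
      using prediction_cost_nonneg[OF wins] by (simp add: \<eta>_def)
    have "?c sums (\<Sum>k. ?c k)"
      using wins by (auto simp: observer_wins_def intro: summable_sums)
    moreover have "(\<lambda>k. of_rat (\<eta> n k) :: real) sums ((1 / 2 ^ (n + 2)) * 1)"
      unfolding of_rat_\<eta> by (intro sums_mult power_half_series)
    ultimately have l: "?l sums ((\<Sum>k. ?c k) + 2 * ((1 / 2 ^ (n + 2)) * 1))"
      by (intro sums_add sums_mult)
    have "emeasure lborel (test_set V n) \<le> (\<Sum>k. emeasure lborel (?I k))"
      unfolding test_set_def by (intro emeasure_subadditive_countably) auto
    also have "\<dots> = (\<Sum>k. ennreal (?l k))"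
    proof (intro suminf_cong)
      fix k
      have "real_of_rat (snd (V n k)) - of_rat (fst (V n k)) = ?l k"
        by (simp add: V_def of_rat_add of_rat_diff of_rat_cost)
      then show "emeasure lborel (?I k) = ennreal (?l k)"
        using nonneg[of k] by (subst emeasure_lborel_Ioo) auto
    qed
    also have "\<dots> = ennreal ((\<Sum>k. ?c k) + 2 * ((1 / 2 ^ (n + 2)) * 1))"
      using nonneg l by (rule suminf_ennreal_sums)
    also have "\<dots> \<le> ennreal (1 / 2 ^ n)"
    proof (rule ennreal_leI)
      have "(\<Sum>k. ?c k) < 1 / 2 ^ Suc n"
        using wins[of n] by (simp add: observer_wins_def of_rat_divide of_rat_power of_rat_mult)
      then show "(\<Sum>k. ?c k) + 2 * ((1 / 2 ^ (n + 2)) * 1) \<le> 1 / 2 ^ n"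
        by (simp add: power_add)
    qed
    finally show ?thesis .
  qed
  moreover have "\<alpha> \<in> test_set V n" for n
  proof -
    obtain i \<delta> where i: "P n i = Some \<delta>" "\<forall>j\<ge>i. a j \<le> a i + \<delta>"
      using wins[of n] by (auto simp: observer_wins_def)
    have "real_of_rat (a i) \<le> \<alpha>"
      using \<open>incseq a\<close> by (intro incseq_le[OF _ lim]) (simp add: incseq_def of_rat_less_eq)
    moreover have "\<alpha> \<le> of_rat (a i + \<delta>)"
      using i(2) by (intro LIMSEQ_le_const2[OF lim]) (auto simp: of_rat_less_eq intro!: exI[of _ i])
    \<comment> \<open>The margin covers the cases where \<open>\<alpha>\<close> equals
      \<open>a i\<close> or \<open>a i + \<delta>\<close>.\<close>
    moreover have "0 < real_of_rat (\<eta> n i)"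
      by (simp add: \<eta>_def)
    ultimately have "real_of_rat (fst (V n i)) < \<alpha>" "\<alpha> < of_rat (snd (V n i))"
      using i(1) by (auto simp: V_def cost_def of_rat_add of_rat_diff simp del: zero_less_of_rat_iff)
    then show ?thesis
      by (auto simp: test_set_def)
  qed
  ultimately show ?thesis
    unfolding martin_loef_random_def martin_loef_test_def by blast
qed


section \<open>From a test to a winning strategy\<close>

text \<open>
  The intervals \<open>k < i\<close> whose right endpoint is at most \<open>a i\<close> do not matter, because the maximum starts
  from \<open>a i\<close>; a prediction with \<open>\<delta> = 0\<close> is free.
\<close>

definition reach :: "(nat \<Rightarrow> rat) \<Rightarrow> (nat \<Rightarrow> rat \<times> rat) \<Rightarrow> nat \<Rightarrow> rat" where
  "reach a I i = rec_nat (a i)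
     (\<lambda>k m. if fst (I k) < a i then if m < snd (I k) then snd (I k) else m else m) i"

text \<open>The value at \<open>i\<close> takes into account only predictions made before time
  \<open>i\<close>. The start below \<open>a 0\<close> forces a prediction at time \<open>0\<close>,
  which is free because \<open>reach a I 0 = a 0\<close>.\<close>

definition predicted_bound :: "(nat \<Rightarrow> rat) \<Rightarrow> (nat \<Rightarrow> rat \<times> rat) \<Rightarrow> nat \<Rightarrow> rat" where
  "predicted_bound a I = rec_nat (a 0 - 1) (\<lambda>i b. if b < a i then reach a I i else b)"

definition greedy_prediction :: "(nat \<Rightarrow> rat) \<Rightarrow> (nat \<Rightarrow> rat \<times> rat) \<Rightarrow> nat \<Rightarrow> rat option" where
  "greedy_prediction a I i =
     (if predicted_bound a I i < a i then Some (reach a I i - a i) else None)"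

lemma predicted_bound_0: "predicted_bound a I 0 = a 0 - 1"
  by (simp add: predicted_bound_def)

lemma predicted_bound_Suc:
  "predicted_bound a I (Suc i) =
     (if predicted_bound a I i < a i then reach a I i else predicted_bound a I i)"
  by (simp add: predicted_bound_def)

lemma computable_greedy_prediction:
  fixes V :: "nat \<Rightarrow> nat \<Rightarrow> rat \<times> rat" and f g :: "'a::encodable \<Rightarrow> nat"
  assumes "computable a" and "computable (\<lambda>(n, k). V n k)" and "computable f" and "computable g"
  shows "computable (\<lambda>x. greedy_prediction a (V (f x)) (g x))"
proof -
  have reach: "computable (\<lambda>x. reach a (V (f x)) (g x))"
    if "computable f" and "computable g" for f g :: "'b::encodable \<Rightarrow> nat"
    unfolding reach_def
    by (intro computable_rec_nat computable_If decidable_less_rat computable_fst computable_snd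
        computable_id computable_curry[OF assms(2)] computable_compose[OF assms(1)]
        computable_compose[OF that(1)] computable_compose[OF that(2)] that(2))
  have "computable (\<lambda>x. predicted_bound a (V (f x)) (g x))"
    unfolding predicted_bound_def
    by (intro computable_rec_nat computable_If decidable_less_rat computable_fst computable_snd
        computable_id computable_const computable_compose[OF assms(1)] reach
        computable_compose[OF assms(3)] assms(4))
  then show ?thesis
    unfolding greedy_prediction_def
    by (intro computable_If decidable_less_rat computable_Some computable_diff_rat
        computable_const computable_compose[OF assms(1)] reach assms(3,4))
qed

section \<open>Invariants of the greedy bound\<close>

lemma reach_ge: "a i \<le> reach a I i"
proof -
  have "a i \<le> rec_nat (a i)
      (\<lambda>k m. if fst (I k) < a i then if m < snd (I k) then snd (I k) else m else m) n" for n
    by (induction n) auto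
  then show ?thesis by (simp add: reach_def)
qed

lemma snd_le_reach:
  assumes "k < i" and "fst (I k) < a i"
  shows "snd (I k) \<le> reach a I i"
proof -
  have "snd (I k) \<le> rec_nat (a i)
      (\<lambda>k m. if fst (I k) < a i then if m < snd (I k) then snd (I k) else m else m) n" if "k < n" for n
    using that
  proof (induction n)
    case 0
    then show ?case by simp
  next
    case (Suc n)
    then show ?case using assms(2) by (cases "k = n") auto
  qed
  then show ?thesis using assms(1) by (simp add: reach_def)
qed

text \<open>A finite maximum is attained. Hence a prediction with \<delta> > 0 ends at the right
  endpoint of an interval that starts below \<open>a i\<close>, and the predicted piece stays inside
  this one interval.\<close>

lemma reach_cases:
  obtains "reach a I i = a i" | k where "fst (I k) < a i" and "reach a I i = snd (I k)"
proof -
  let ?r = "rec_nat (a i)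
      (\<lambda>k m. if fst (I k) < a i then if m < snd (I k) then snd (I k) else m else m)"
  have "?r n = a i \<or> (\<exists>k. fst (I k) < a i \<and> ?r n = snd (I k))" for n
    by (induction n) auto
  then show thesis
    using that by (auto simp: reach_def)
qed

text \<open>The bound changes only when \<open>a i\<close> exceeds it, and by
  \<open>reach_ge\<close> its new value is at least \<open>a i\<close>.\<close>

lemma mono_predicted_bound: "mono (predicted_bound a I)"
  unfolding incseq_Suc_iff predicted_bound_Suc
  by (simp add: less_imp_le[OF less_le_trans[OF _ reach_ge]])

text \<open>When predictions cease, the bound in force has to be traced back to a prediction that
  was really made; the first case is that of the initial bound.\<close>

lemma predicted_bound_cases:
  obtains "predicted_bound a I n < a 0"
  | i where "i < n" and "predicted_bound a I i < a i" and "predicted_bound a I n = reach a I i"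
proof -
  have "predicted_bound a I n < a 0 \<or>
      (\<exists>i<n. predicted_bound a I i < a i \<and> predicted_bound a I n = reach a I i)"
    by (induction n) (auto simp: predicted_bound_0 predicted_bound_Suc less_Suc_eq)
  then show thesis using that by auto
qed

text \<open>The measure bound is not strict, but the game asks for a sum strictly below
  \<open>\<epsilon>\<close>; the number \<open>c\<close> between them bridges the gap.\<close>

lemma greedy_prediction_wins:
  fixes a :: "nat \<Rightarrow> rat"
  assumes inc: "incseq a" and lim: "(\<lambda>i. of_rat (a i)) \<longlonglongrightarrow> \<alpha>"
    and \<alpha>: "\<alpha> \<in> test_set V n" and small: "emeasure lborel (test_set V n) \<le> ennreal c"
    and c: "0 \<le> c" "c < of_rat \<epsilon>"
  shows "observer_wins a \<epsilon> (greedy_prediction a (V n))"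
proof -
  let ?I = "V n"
  let ?b = "predicted_bound a ?I"
  let ?P = "greedy_prediction a ?I"
  \<comment> \<open>Half-open pieces fit into the open intervals of the test: \<open>a i\<close>
    lies strictly to the right of a left endpoint, while the bound may be the excluded right
    endpoint.\<close>
  define A where "A i = (if ?b i < a i then {real_of_rat (a i) ..< of_rat (reach a ?I i)} else {})" for i

  have le: "real_of_rat (a i) \<le> \<alpha>" for i
    using inc by (intro incseq_le[OF _ lim]) (simp add: incseq_def of_rat_less_eq)
  have emeasure_A: "emeasure lborel (A i) = ennreal (prediction_cost (?P i))" for i
    by (simp add: A_def greedy_prediction_def prediction_cost_def reach_ge of_rat_less_eq of_rat_diff)
  have measurable: "A i \<in> sets lborel" for i
    by (simp add: A_def)
  have "A i \<inter> A j = {}" if "i < j" for i j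
  proof (cases "?b i < a i \<and> ?b j < a j")
    case True
    \<comment> \<open>A prediction at \<open>j\<close> requires \<open>a j\<close> above the current
      bound, which by monotonicity is at least the one predicted at \<open>i\<close>.\<close>
    have "reach a ?I i = ?b (Suc i)"
      using True by (simp add: predicted_bound_Suc)
    also have "\<dots> \<le> ?b j"
      using that by (intro monoD[OF mono_predicted_bound]) simp
    also have "\<dots> < a j"
      using True by simp
    finally have "real_of_rat (reach a ?I i) < of_rat (a j)"
      by (simp add: of_rat_less)
    then show ?thesis
      by (auto simp: A_def)
  qed (auto simp: A_def)
  then have disjoint: "disjoint_family A"
    unfolding disjoint_family_on_def by (metis inf_commute linorder_neqE_nat)
  have "A i \<subseteq> test_set V n" for i
  proof (cases rule: reach_cases[of a ?I i])
    case (2 k)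
    then have "real_of_rat (fst (V n k)) < of_rat (a i)"
      by (simp add: of_rat_less)
    with 2 have "A i \<subseteq> {of_rat (fst (V n k)) <..< of_rat (snd (V n k))}"
      by (auto simp: A_def)
    then show ?thesis by (auto simp: test_set_def)
  qed (simp add: A_def)
  then have "emeasure lborel (\<Union>i. A i) \<le> ennreal c"
    by (intro order_trans[OF emeasure_mono small]) (auto simp: test_set_def)
  moreover have "(\<Sum>i. emeasure lborel (A i)) = emeasure lborel (\<Union>i. A i)"
    using disjoint measurable by (intro suminf_emeasure) auto
  ultimately have sum: "(\<Sum>i. ennreal (prediction_cost (?P i))) \<le> ennreal c"
    by (simp add: emeasure_A)
  have nonneg: "0 \<le> prediction_cost (?P i)" for i
    by (simp add: greedy_prediction_def prediction_cost_def reach_ge of_rat_less_eq of_rat_diff)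
  have summable: "summable (\<lambda>i. prediction_cost (?P i))"
    using nonneg sum by (intro summable_suminf_not_top) (auto simp: top_unique)
  have "(\<Sum>i. prediction_cost (?P i)) \<le> c"
    using sum unfolding suminf_ennreal2[OF nonneg summable] ennreal_le_iff[OF c(1)] .
  with c have less: "(\<Sum>i. prediction_cost (?P i)) < of_rat \<epsilon>"
    by simp

  have "\<exists>i. ?b i < a i \<and> (\<forall>j. a j \<le> reach a ?I i)"
  proof -
    obtain k where k: "of_rat (fst (V n k)) < \<alpha>" "\<alpha> < of_rat (snd (V n k))"
      using \<alpha> by (auto simp: test_set_def)
    from order_tendstoD(1)[OF lim k(1)]
    obtain J0 where J0: "\<And>j. j \<ge> J0 \<Longrightarrow> fst (V n k) < a j"
      by (auto simp: eventually_sequentially of_rat_less)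
    \<comment> \<open>From \<open>J\<close> on, the terms lie to the right of the left endpoint of
      interval \<open>k\<close>, and \<open>k\<close> is among the intervals inspected.\<close>
    define J where "J = max J0 (Suc k)"
    show ?thesis
    proof (cases "\<exists>j\<ge>J. ?b j < a j")
      case True
      \<comment> \<open>The prediction at \<open>j\<close> reaches at least the right endpoint of
        interval \<open>k\<close>, which exceeds \<open>\<alpha>\<close> and hence every
        term.\<close>
      then obtain j where j: "j \<ge> J" "?b j < a j" by blast
      then have "snd (V n k) \<le> reach a ?I j"
        using J0 by (intro snd_le_reach) (auto simp: J_def)
      moreover have "a m \<le> snd (V n k)" for m
        using le_less_trans[OF le k(2), of m] by (simp add: of_rat_less)
      ultimately show ?thesis
        using j(2) by (blast intro: order_trans)
    next
      case False
      \<comment> \<open>Without new predictions the bound is frozen at \<open>?b J\<close>. It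
        dominates all terms from \<open>J\<close> on, and the earlier ones because \<open>a\<close>
        is increasing.\<close>
      have "?b j = ?b J" if "J \<le> j" for j
        using that by (induction j rule: dec_induct) (use False in \<open>auto simp: predicted_bound_Suc\<close>)
      with False have "a j \<le> ?b J" if "J \<le> j" for j
        using that by (metis not_less)
      then have bound: "a j \<le> ?b J" for j
        using inc by (metis incseqD linear order_trans)
      show ?thesis
      proof (cases rule: predicted_bound_cases[of a ?I J])
        \<comment> \<open>A bound below \<open>a 0\<close> cannot dominate the term
          \<open>a 0\<close>.\<close>
        case 1
        with bound[of 0] show ?thesis by simp
      next
        case (2 i)
        with bound show ?thesis by auto
      qed
    qed
  qed
  then have "\<exists>i \<delta>. ?P i = Some \<delta> \<and> (\<forall>j\<ge>i. a j \<le> a i + \<delta>)"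
    by (auto simp: greedy_prediction_def)
  then show ?thesis
    using summable less reach_ge[of a _ ?I]
    by (auto simp: observer_wins_def greedy_prediction_def)
qed

text \<open>A positive rational with denominator \<open>d\<close> is at least \<open>1 / d\<close>,
  and \<open>d < 2 ^ d\<close>. So the denominator of \<open>\<epsilon>\<close> is a computable
  choice of a sufficiently small level of the test.\<close>

lemma inverse_power2_rat_den_less:
  assumes "0 < \<epsilon>"
  shows "1 / 2 ^ rat_den \<epsilon> < real_of_rat \<epsilon>"
proof -
  let ?d = "rat_den \<epsilon>"
  have d: "int ?d = snd (quotient_of \<epsilon>)"
    using quotient_of_denom_pos'[of \<epsilon>] by (simp add: rat_den_def)
  have "\<epsilon> = of_int (fst (quotient_of \<epsilon>)) / of_nat ?d"
    using quotient_of_div[OF surjective_pairing, of \<epsilon>] unfolding d[symmetric] of_int_of_nat_eq .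
  then have eq: "real_of_rat \<epsilon> = of_int (fst (quotient_of \<epsilon>)) / of_nat ?d"
    by (metis of_rat_divide of_rat_of_int_eq of_rat_of_nat_eq)
  have "0 < real_of_rat \<epsilon>"
    using assms by simp
  then have "1 \<le> fst (quotient_of \<epsilon>)"
    using rat_den_pos[of \<epsilon>] unfolding eq by (simp add: zero_less_divide_iff)
  then have "1 / real ?d \<le> real_of_rat \<epsilon>"
    unfolding eq by (intro divide_right_mono) auto
  moreover have "1 / 2 ^ ?d < 1 / real ?d"
    using rat_den_pos[of \<epsilon>] by (intro divide_strict_left_mono) (auto simp: of_nat_less_two_power)
  ultimately show ?thesis by simp
qed

lemma strategy_if_not_random:
  fixes a :: "nat \<Rightarrow> rat"
  assumes "computable a" and "incseq a" and "(\<lambda>i. of_rat (a i)) \<longlonglongrightarrow> \<alpha>"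
    and "\<not> martin_loef_random \<alpha>"
  shows "\<exists>S. computable_winning_strategy a S"
proof -
  obtain V where V: "martin_loef_test V" "\<And>n. \<alpha> \<in> test_set V n"
    using assms(4) by (auto simp: martin_loef_random_def)
  \<comment> \<open>\<open>history a i\<close> has \<open>Suc i\<close> entries, so
    \<open>length h - 1\<close> recovers the time \<open>i\<close>.\<close>
  define S where "S \<epsilon> h = greedy_prediction a (V (rat_den \<epsilon>)) (length h - 1)"
    for \<epsilon> and h :: "rat list"
  have "computable (\<lambda>x. S (fst x) (snd x))"
    unfolding S_def using V(1)
    by (intro computable_greedy_prediction computable_rat_den computable_diff_nat computable_length
        computable_const computable_fst computable_snd computable_id assms(1))
      (simp add: martin_loef_test_def)
  then have "computable_on D (\<lambda>(\<epsilon>, h). S \<epsilon> h)" for D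
    unfolding computable_on_def case_prod_unfold by blast
  moreover have "observer_wins a \<epsilon> (\<lambda>i. S \<epsilon> (history a i))" if "0 < \<epsilon>" for \<epsilon>
  proof -
    have "(\<lambda>i. S \<epsilon> (history a i)) = greedy_prediction a (V (rat_den \<epsilon>))"
      by (simp add: S_def history_def fun_eq_iff)
    then show ?thesis
      using V inverse_power2_rat_den_less[OF that]
      by (auto simp: martin_loef_test_def intro!: greedy_prediction_wins[OF assms(2,3)])
  qed
  ultimately show ?thesis
    unfolding computable_winning_strategy_def by blast
qed

theorem theorem4:
  fixes a :: "nat \<Rightarrow> rat" and \<alpha> :: real
  assumes "computable a"
    and "incseq a"
    and "(\<lambda>i. of_rat (a i)) \<longlonglongrightarrow> \<alpha>"
  shows "(\<exists>S. computable_winning_strategy a S) \<longleftrightarrow> \<not> martin_loef_random \<alpha>"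
  using not_random_if_strategy[OF assms] strategy_if_not_random[OF assms] by blast

end
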